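(* Let $\mathcal{K}$ be a class of polynomials such that $\mathcal{K}_{\mathrm{SOMS}} \subseteq \mathcal{K}$. Let polynomials $g_1,\dots,g_m \in \mathbb{R}[x]=\mathbb{R}[x_1,\dots,x_n]$, $r>0$, and $U_j>0$ such that $U_j \ge \max\{g_j(x) : x \in \mathcal{B}_r\}$, $j=1,\dots,m$, be given. Let $p \in \mathbb{R}[x]$. If $p(x)>0$ for all $x \in \{x \in \mathcal{B}_r : g_j(x)\ge 0,\ j=1,\dots,m\}$, then there exist $(2n+1)$-variate polynomials $\alpha_j(y,z,u)\in\mathcal{K}$ (with $y=(y_1,\dots,y_n)$, $z=(z_1,\dots,z_n)$, and $u$ a single variable) for $j=0,1$, and univariate polynomials $\rho_j(u)\in\mathcal{K}$, $j=1,\dots,m$, such that $$p(x)=\alpha_0(x+re,\,re-x,\,r^2-\|x\|^2)+\alpha_1(x+re,\,re-x,\,r^2-\|x\|^2)\,(r^2-\|x\|^2)+\sum_{j=1}^m \rho_j(U_j-g_j(x))\,g_j(x)$$ as polynomials in $x$.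
   Context: $\|\cdot\|$ is the Euclidean norm, $\mathcal{B}_r=\{x\in\mathbb{R}^n:\|x\|\le r\}$, and $e$ is the all-ones vector of appropriate dimension. A class of polynomials $\mathcal{K}$ is a set of real polynomials, understood to contain polynomials in any (finite) number of variables; inclusions between classes are understood for every number of variables. A real polynomial $q$ in variables $w=(w_1,\dots,w_s)$ is a sum of monomial squares (SOMS) if $q(w)=\sum_{\alpha\in A}\lambda_\alpha w^{2\alpha}$ for some finite $A\subseteq\mathbb{N}^s$ and $\lambda_\alpha\ge 0$ for all $\alpha\in A$. $\mathcal{K}_{\mathrm{SOMS}}$ denotes the class of all SOMS polynomials (in any number of variables). *)

theory Defs
  imports "HOL-Analysis.Analysis" "HOL-Library.Poly_Mapping"
begin

text \<open>
  Real multivariate polynomials: finitely supported maps from exponent vectors to coefficients,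
  with the ring structure of \<^theory>\<open>HOL-Library.Poly_Mapping\<close>. Variables are numbered from 0,
  so $x_1, \dots, x_n$ are the variables with index \<open>0, \<dots>, n - 1\<close>.
\<close>

type_synonym rpoly = "(nat \<Rightarrow>\<^sub>0 nat) \<Rightarrow>\<^sub>0 real"

definition PConst :: "real \<Rightarrow> rpoly" where
  "PConst c = Poly_Mapping.single 0 c"

definition PVar :: "nat \<Rightarrow> rpoly" where
  "PVar i = Poly_Mapping.single (Poly_Mapping.single i 1) 1"

definition polys :: "nat \<Rightarrow> rpoly set" where
  "polys s = {p. \<forall>a\<in>Poly_Mapping.keys p. Poly_Mapping.keys a \<subseteq> {..<s}}"

definition peval :: "(nat \<Rightarrow> real) \<Rightarrow> rpoly \<Rightarrow> real" where
  "peval x p = (\<Sum>a\<in>Poly_Mapping.keys p. Poly_Mapping.lookup p a *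
     (\<Prod>i\<in>Poly_Mapping.keys a. x i ^ Poly_Mapping.lookup a i))"

definition psubst :: "(nat \<Rightarrow> rpoly) \<Rightarrow> rpoly \<Rightarrow> rpoly" where
  "psubst f p = (\<Sum>a\<in>Poly_Mapping.keys p. PConst (Poly_Mapping.lookup p a) *
     (\<Prod>i\<in>Poly_Mapping.keys a. f i ^ Poly_Mapping.lookup a i))"

text \<open>
  A class of polynomials contains polynomials in any finite number of variables; it is given by
  its set \<open>K s\<close> of \<open>s\<close>-variate members for every \<open>s\<close>.
\<close>

definition poly_class :: "(nat \<Rightarrow> rpoly set) \<Rightarrow> bool" where
  "poly_class K \<longleftrightarrow> (\<forall>s. K s \<subseteq> polys s)"

text \<open>The monomial $w^{2\alpha}$ has exponent vector \<open>a + a\<close>.\<close>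

definition SOMS :: "nat \<Rightarrow> rpoly set" where
  "SOMS s = {q. \<exists>(A :: (nat \<Rightarrow>\<^sub>0 nat) set) (c :: (nat \<Rightarrow>\<^sub>0 nat) \<Rightarrow> real).
     finite A \<and> (\<forall>a\<in>A. Poly_Mapping.keys a \<subseteq> {..<s}) \<and> (\<forall>a\<in>A. c a \<ge> 0) \<and>
     q = (\<Sum>a\<in>A. Poly_Mapping.single (a + a) (c a))}"

text \<open>
  Points of $\mathbb{R}^n$ are the functions vanishing at all indices \<open>\<ge> n\<close>,
  as in \<^const>\<open>Euclidean_space\<close>.
\<close>

definition Rball :: "nat \<Rightarrow> real \<Rightarrow> (nat \<Rightarrow> real) set" where
  "Rball n r = {x. (\<forall>i\<ge>n. x i = 0) \<and> L2_set x {..<n} \<le> r}"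

definition ball_poly :: "nat \<Rightarrow> real \<Rightarrow> rpoly" where
  "ball_poly n r = PConst (r\<^sup>2) - (\<Sum>i<n. PVar i ^ 2)"

text \<open>
  The substitution $(y, z, u) \mapsto (x + r e,\; r e - x,\; r^2 - \|x\|^2)$: in \<open>2 * n + 1\<close>
  variables, $y$ occupies the indices \<open>0, \<dots>, n - 1\<close>, $z$ the indices \<open>n, \<dots>, 2 * n - 1\<close>,
  and $u$ the index \<open>2 * n\<close>.
\<close>

definition ball_subst :: "nat \<Rightarrow> real \<Rightarrow> nat \<Rightarrow> rpoly" where
  "ball_subst n r i =
     (if i < n then PVar i + PConst r
      else if i < 2 * n then PConst r - PVar (i - n)
      else ball_poly n r)"

end

theory Submission
  imports Defs
begin

text \<open>
  It suffices to find multipliers that are sums of monomial squares, since \<open>K\<close> contains them.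
  The proof has two independent halves.

  The constraints are removed first. For the even monomial \<open>\<rho> j = (u / U j) ^ (2 * N)\<close>
  the function \<open>\<rho> j (U j - g j) * g j\<close> is at most \<open>U j / (2 * N)\<close> on the ball where
  \<open>g j \<ge> 0\<close>, is nonpositive where \<open>g j < 0\<close>, and tends to minus infinity where \<open>g j\<close> stays
  below a negative constant. By compactness, a single large \<open>N\<close> therefore makes
  \<open>f = p - (\<Sum>j. \<rho> j (U j - g j) * g j)\<close> positive on the whole ball
  (\<open>damping_multipliers\<close>).

  It remains to represent a polynomial \<open>f\<close> that is positive on the ball. Write
  \<open>y\<^sub>i = x\<^sub>i + r\<close>, \<open>z\<^sub>i = r - x\<^sub>i\<close> and \<open>u = r\<^sup>2 - \<parallel>x\<parallel>\<^sup>2\<close>. With \<open>\<alpha>\<^sub>0\<close> and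
  \<open>\<alpha>\<^sub>1\<close> one can produce all nonnegative combinations of products of the \<open>y\<^sub>i\<^sup>2\<close>, the
  \<open>z\<^sub>i\<^sup>2\<close> and \<open>u\<close>: even powers of \<open>u\<close> go to \<open>\<alpha>\<^sub>0\<close> and odd ones to \<open>\<alpha>\<^sub>1\<close>. The key is the
  identity \<open>(\<Sum>i. y\<^sub>i\<^sup>2 + z\<^sub>i\<^sup>2) + 2 * u = 2 * (n + 1) * r\<^sup>2\<close>. After scaling,
  these \<open>2 * n + 1\<close> generators sum to one, like barycentric coordinates, and they recover
  the variables because \<open>y\<^sub>i\<^sup>2 - z\<^sub>i\<^sup>2 = 4 * r * x\<^sub>i\<close>. So \<open>f\<close> is a polynomial \<open>F\<close>
  in the generators, and if \<open>F\<close> is positive on the standard simplex, a theorem in the style of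
  Polya (\<open>polya\<close>) writes \<open>f\<close> with nonnegative coefficients: multiply each monomial of \<open>F\<close> by a
  power of the sum of the generators, which is one, until all monomials have degree \<open>N\<close>; the
  coefficients approach the values of \<open>F\<close> at the points of the simplex with denominator \<open>N\<close>.

  A priori \<open>F\<close> is positive only on the image of the ball in the simplex. That image is the
  zero set of \<open>H = (\<Sum>i. (y\<^sub>i\<^sup>2 - (x\<^sub>i + r)\<^sup>2)\<^sup>2)\<close>, where \<open>y\<^sub>i\<^sup>2\<close> and \<open>x\<^sub>i\<close> are read as
  functions on the simplex (\<open>coord_of_simplex_in_Rball\<close>). As a polynomial in the generators \<open>H\<close>
  evaluates to zero, so a large multiple of it can be added to \<open>F\<close>: this changes nothing in
  the polynomial ring and makes the function positive on the whole simplex.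
\<close>

section \<open>Evaluation of polynomials\<close>

definition monom_eval :: "(nat \<Rightarrow> 'b::comm_ring_1) \<Rightarrow> (nat \<Rightarrow>\<^sub>0 nat) \<Rightarrow> 'b" where
  "monom_eval f a = (\<Prod>i\<in>Poly_Mapping.keys a. f i ^ Poly_Mapping.lookup a i)"

text \<open>
  Evaluation at a real point and substitution of polynomials are the same construction over two
  coefficient homomorphisms, so that one proof shows that both are ring homomorphisms.
\<close>

definition eval_along :: "(real \<Rightarrow> 'b::comm_ring_1) \<Rightarrow> (nat \<Rightarrow> 'b) \<Rightarrow> rpoly \<Rightarrow> 'b" where
  "eval_along \<iota> f p =
     (\<Sum>a\<in>Poly_Mapping.keys p. \<iota> (Poly_Mapping.lookup p a) * monom_eval f a)"

lemma monom_eval_superset: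
  assumes "finite B" "Poly_Mapping.keys a \<subseteq> B"
  shows "monom_eval f a = (\<Prod>i\<in>B. f i ^ Poly_Mapping.lookup a i)"
  unfolding monom_eval_def
  by (rule prod.mono_neutral_left) (use assms in \<open>auto simp: in_keys_iff\<close>)

lemma monom_eval_add: "monom_eval f (a + b) = monom_eval f a * monom_eval f b"
proof -
  let ?B = "Poly_Mapping.keys a \<union> Poly_Mapping.keys b"
  have "monom_eval f (a + b) = (\<Prod>i\<in>?B. f i ^ Poly_Mapping.lookup (a + b) i)"
    by (rule monom_eval_superset) (use keys_add[of a b] in auto)
  also have "\<dots> = (\<Prod>i\<in>?B. f i ^ Poly_Mapping.lookup a i) * (\<Prod>i\<in>?B. f i ^ Poly_Mapping.lookup b i)"
    by (simp add: lookup_add power_add prod.distrib)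
  also have "\<dots> = monom_eval f a * monom_eval f b"
    by (simp add: monom_eval_superset[of ?B])
  finally show ?thesis .
qed

lemma monom_eval_zero [simp]: "monom_eval f 0 = 1"
  by (simp add: monom_eval_def)

lemma monom_eval_single [simp]: "monom_eval f (Poly_Mapping.single i m) = f i ^ m"
  by (cases "m = 0") (auto simp: monom_eval_def)

lemma sum_single_keys:
  "(\<Sum>a\<in>Poly_Mapping.keys p. Poly_Mapping.single a (Poly_Mapping.lookup p a)) = p"
proof (rule poly_mapping_eqI)
  fix k
  show "Poly_Mapping.lookup (\<Sum>a\<in>Poly_Mapping.keys p.
      Poly_Mapping.single a (Poly_Mapping.lookup p a)) k = Poly_Mapping.lookup p k"
    by (cases "k \<in> Poly_Mapping.keys p") (simp_all add: lookup_sum lookup_single when_def in_keys_iff)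
qed

locale coeff_hom =
  fixes \<iota> :: "real \<Rightarrow> 'b::comm_ring_1"
  assumes hom_add: "\<iota> (c + d) = \<iota> c + \<iota> d"
    and hom_mult: "\<iota> (c * d) = \<iota> c * \<iota> d"
    and hom_one: "\<iota> 1 = 1"
begin

lemma hom_zero: "\<iota> 0 = 0"
  using hom_add[of 0 0] by simp

lemma eval_single: "eval_along \<iota> f (Poly_Mapping.single a c) = \<iota> c * monom_eval f a"
  by (auto simp: eval_along_def hom_zero)

lemma eval_add: "eval_along \<iota> f (p + q) = eval_along \<iota> f p + eval_along \<iota> f q"
  unfolding eval_along_def
  by (rule setsum_keys_plus_distrib[where f = "\<lambda>a c. \<iota> c * monom_eval f a"])
     (auto simp: hom_zero hom_add distrib_right)

lemma eval_zero: "eval_along \<iota> f 0 = 0"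
  by (simp add: eval_along_def)

lemma eval_sum: "eval_along \<iota> f (sum P A) = (\<Sum>a\<in>A. eval_along \<iota> f (P a))"
  by (induction A rule: infinite_finite_induct) (auto simp: eval_add eval_zero)

lemma eval_diff: "eval_along \<iota> f (p - q) = eval_along \<iota> f p - eval_along \<iota> f q"
  using eval_add[of f "p - q" q] by simp

lemma eval_mult: "eval_along \<iota> f (p * q) = eval_along \<iota> f p * eval_along \<iota> f q"
proof -
  let ?s = "\<lambda>r a. Poly_Mapping.single a (Poly_Mapping.lookup r a)"
  have "p * q = (\<Sum>a\<in>Poly_Mapping.keys p. \<Sum>b\<in>Poly_Mapping.keys q. ?s p a * ?s q b)"
    by (simp add: sum_product[symmetric] sum_single_keys)
  then have "eval_along \<iota> f (p * q) =
      (\<Sum>a\<in>Poly_Mapping.keys p. \<Sum>b\<in>Poly_Mapping.keys q.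
         eval_along \<iota> f (?s p a * ?s q b))"
    by (simp only: eval_sum)
  also have "\<dots> = (\<Sum>a\<in>Poly_Mapping.keys p. \<Sum>b\<in>Poly_Mapping.keys q.
         (\<iota> (Poly_Mapping.lookup p a) * monom_eval f a) *
         (\<iota> (Poly_Mapping.lookup q b) * monom_eval f b))"
    by (simp add: mult_single eval_single monom_eval_add hom_mult mult_ac)
  also have "\<dots> = eval_along \<iota> f p * eval_along \<iota> f q"
    by (simp add: eval_along_def sum_product)
  finally show ?thesis .
qed

lemma eval_power: "eval_along \<iota> f (p ^ k) = eval_along \<iota> f p ^ k"
  by (induction k) (auto simp: eval_mult eval_single[of f 0 1, simplified] hom_one)

end

lemma PConst_zero: "PConst 0 = 0"
  and PConst_one: "PConst 1 = 1"
  and PConst_add: "PConst (c + d) = PConst c + PConst d"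
  and PConst_mult: "PConst (c * d) = PConst c * PConst d"
  by (simp_all add: PConst_def single_add mult_single)

lemma PConst_power: "PConst (c ^ k) = PConst c ^ k"
  by (induction k) (simp_all add: PConst_mult PConst_one)

lemma peval_eq_eval_along: "peval x = eval_along id x"
  by (simp add: fun_eq_iff peval_def eval_along_def monom_eval_def)

lemma psubst_eq_eval_along: "psubst f = eval_along PConst f"
  by (simp add: fun_eq_iff psubst_def eval_along_def monom_eval_def)

interpretation peval: coeff_hom "id :: real \<Rightarrow> real"
  by standard auto

interpretation psubst: coeff_hom PConst
  by standard (simp_all add: PConst_one PConst_add PConst_mult)

lemmas peval_simps =
  peval.eval_add[folded peval_eq_eval_along]
  peval.eval_diff[folded peval_eq_eval_along]
  peval.eval_mult[folded peval_eq_eval_along]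
  peval.eval_power[folded peval_eq_eval_along]
  peval.eval_sum[folded peval_eq_eval_along]

lemma peval_PConst [simp]: "peval x (PConst c) = c"
  by (simp add: peval_eq_eval_along PConst_def peval.eval_single)

lemmas psubst_simps =
  psubst.eval_zero[folded psubst_eq_eval_along]
  psubst.eval_add[folded psubst_eq_eval_along]
  psubst.eval_mult[folded psubst_eq_eval_along]
  psubst.eval_single[folded psubst_eq_eval_along]

lemma continuous_on_peval: "continuous_on S (\<lambda>x. peval x p)"
  unfolding peval_def
  by (intro continuous_intros continuous_on_subset[OF continuous_on_product_coordinates]) auto

lemma polys_PConst: "PConst c \<in> polys s"
  by (auto simp: polys_def PConst_def)

lemma polys_diff: "p \<in> polys s \<Longrightarrow> q \<in> polys s \<Longrightarrow> p - q \<in> polys s"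
  using keys_diff[of p q] unfolding polys_def by blast

lemma polys_sum: "(\<And>i. i \<in> A \<Longrightarrow> P i \<in> polys s) \<Longrightarrow> sum P A \<in> polys s"
  using keys_sum[of P A] unfolding polys_def by blast

lemma polys_mult: 
  assumes "p \<in> polys s" "q \<in> polys s" 
  shows "p * q \<in> polys s"
  unfolding polys_def
proof safe
  fix c i assume "c \<in> Poly_Mapping.keys (p * q)" "i \<in> Poly_Mapping.keys c"
  then obtain a b where "a \<in> Poly_Mapping.keys p" "b \<in> Poly_Mapping.keys q" 
    "i \<in> Poly_Mapping.keys (a + b)"
    using keys_mult[of p q] by blast
  then show "i < s"
    using assms keys_add[of a b] unfolding polys_def by blast
qed

lemma polys_power: "p \<in> polys s \<Longrightarrow> p ^ k \<in> polys s"
  by (induction k) (auto simp: polys_mult polys_PConst[of 1, unfolded PConst_one])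

lemma single_eq_PConst_prod:
  "Poly_Mapping.single a c =
    PConst c * (\<Prod>i\<in>Poly_Mapping.keys a. PVar i ^ Poly_Mapping.lookup a i)"
proof -
  have pow: "PVar i ^ k = Poly_Mapping.single (Poly_Mapping.single i k) 1" for i k
    by (induction k) (auto simp: PVar_def mult_single single_add[symmetric])
  have "(\<Prod>i\<in>B. Poly_Mapping.single (e i) (1::real)) = Poly_Mapping.single (sum e B) 1" 
    if "finite B" for B :: "nat set" and e :: "nat \<Rightarrow> nat \<Rightarrow>\<^sub>0 nat"
    using that by (induction B) (auto simp: mult_single)
  then show ?thesis
    by (simp add: pow sum_single_keys PConst_def mult_single)
qed

section \<open>The Bernstein expansion on a simplex\<close>

text \<open>
  Adding \<open>h\<close> to coordinate \<open>i\<close>. Vectors of letter counts are real-valued, so that decrementing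
  a coordinate never truncates and the identities below need no side conditions.
\<close>

definition bump :: "nat \<Rightarrow> (nat \<Rightarrow> real) \<Rightarrow> real \<Rightarrow> nat \<Rightarrow> real" where
  "bump i v h = (\<lambda>j. if j = i then v j + h else v j)"

lemma bump_cancel: "bump i (bump i v 1) (-1) = v" "bump i (bump i v (-1)) 1 = v"
  by (auto simp: bump_def)

lemma bump_commute: "bump i (bump j v h) h' = bump j (bump i v h') h"
  by (auto simp: bump_def)

lemma bump_at: "bump i v h j = (if j = i then v j + h else v j)"
  by (simp add: bump_def)

definition std_simplex :: "nat \<Rightarrow> real \<Rightarrow> (nat \<Rightarrow> real) set" where
  "std_simplex k M = {v. (\<forall>i. 0 \<le> v i) \<and> (\<forall>i\<ge>k. v i = 0) \<and> (\<Sum>i<k. v i) = M}"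

text \<open>
  With \<open>l\<^sub>w\<close> the product of the \<open>l\<close> along a word \<open>w\<close>, this is the sum of \<open>\<phi> (c w) * l\<^sub>w\<close> over
  all words \<open>w\<close> of length \<open>N\<close> over \<open>{..<k}\<close>, where \<open>c w\<close> counts the occurrences of each letter.
  Grouping words by their counts would give Bernstein sums with multinomial coefficients; the
  recursion over the first letter avoids these.
\<close>

primrec word_sum :: "(nat \<Rightarrow> rpoly) \<Rightarrow> nat \<Rightarrow> nat \<Rightarrow> ((nat \<Rightarrow> real) \<Rightarrow> real) \<Rightarrow> rpoly" where
  "word_sum l k 0 \<phi> = PConst (\<phi> (\<lambda>_. 0))"
| "word_sum l k (Suc N) \<phi> = (\<Sum>i<k. l i * word_sum l k N (\<lambda>v. \<phi> (bump i v 1)))"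

lemma word_sum_add:
  "word_sum l k N (\<lambda>v. \<phi> v + \<psi> v) = word_sum l k N \<phi> + word_sum l k N \<psi>"
  by (induction N arbitrary: \<phi> \<psi>) (simp_all add: PConst_add distrib_left sum.distrib)

lemma word_sum_scale:
  "word_sum l k N (\<lambda>v. c * \<phi> v) = PConst c * word_sum l k N \<phi>"
  by (induction N arbitrary: \<phi>) (simp_all add: PConst_mult sum_distrib_left mult_ac)

lemma word_sum_const:
  assumes "(\<Sum>i<k. l i) = 1"
  shows "word_sum l k N (\<lambda>v. c) = PConst c"
  by (induction N) (simp_all add: sum_distrib_right[symmetric] assms)

text \<open>
  Raising the degree by one: a word of length \<open>N + 1\<close> with a marked occurrence of \<open>i\<close> is a
  word of length \<open>N\<close> with \<open>i\<close> inserted at one of \<open>N + 1\<close> places. The factor \<open>v i\<close> counts the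
  marks. The proof splits off the first letter, which is either the marked one or not.
\<close>

lemma word_sum_coordinate:
  assumes "i < k"
  shows "word_sum l k (Suc N) (\<lambda>v. v i * \<phi> (bump i v (-1)))
    = PConst (real (Suc N)) * (l i * word_sum l k N \<phi>)"
proof (induction N arbitrary: \<phi>)
  case 0
  have "(\<Sum>j<k. l j * PConst (bump j (\<lambda>_. 0) 1 i * \<phi> (bump i (bump j (\<lambda>_. 0) 1) (-1))))
     = l i * PConst (\<phi> (\<lambda>_. 0))"
    using assms 
    by (subst sum.remove[of _ i]) (auto simp: PConst_zero bump_cancel bump_at intro!: sum.neutral)
  then show ?case
    by (simp add: PConst_one)
next
  case (Suc N)
  have shift: "(\<lambda>v. bump j v 1 i * \<phi> (bump i (bump j v 1) (-1))) =
      (\<lambda>v. v i * \<phi> (bump j (bump i v (-1)) 1) + (if j = i then 1 else 0) * \<phi> v)" for j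
    by (cases "j = i") (simp_all add: fun_eq_iff bump_cancel bump_at bump_commute[of i j] distrib_right)
  let ?W = "word_sum l k"
  have "?W (Suc (Suc N)) (\<lambda>v. v i * \<phi> (bump i v (-1)))
      = (\<Sum>j<k. l j * ?W (Suc N) (\<lambda>v. v i * \<phi> (bump j (bump i v (-1)) 1)))
        + (\<Sum>j<k. l j * (PConst (if j = i then 1 else 0) * ?W (Suc N) \<phi>))"
    by (subst word_sum.simps) 
       (simp only: shift word_sum_add word_sum_scale distrib_left sum.distrib)
  also have "(\<Sum>j<k. l j * (PConst (if j = i then 1 else 0) * ?W (Suc N) \<phi>)) = l i * ?W (Suc N) \<phi>"
    using assms by (subst sum.remove[of _ i]) (auto simp: PConst_zero PConst_one intro!: sum.neutral)
  also have "(\<Sum>j<k. l j * ?W (Suc N) (\<lambda>v. v i * \<phi> (bump j (bump i v (-1)) 1)))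
     = (\<Sum>j<k. l j * (PConst (real (Suc N)) * (l i * ?W N (\<lambda>v. \<phi> (bump j v 1)))))"
    by (simp only: Suc.IH[of "\<lambda>v. \<phi> (bump _ v 1)"])
  also have "\<dots> = PConst (real (Suc N)) * (l i * ?W (Suc N) \<phi>)"
    by (simp add: sum_distrib_left mult_ac)
  also have "\<dots> + l i * ?W (Suc N) \<phi> = PConst (real (Suc N) + 1) * (l i * ?W (Suc N) \<phi>)"
    by (simp only: PConst_add PConst_one distrib_right mult_1_left)
  finally show ?case by (simp only: of_nat_Suc[of "Suc N"] add.commute)
qed

lemma bump_simplex:
  assumes "v \<in> std_simplex k M" "i < k"
  shows "bump i v 1 \<in> std_simplex k (M + 1)"
proof -
  have "(\<Sum>j<k. bump i v 1 j) = (\<Sum>j<k. v j + (if j = i then 1 else 0))"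
    by (intro sum.cong) (auto simp: bump_def)
  with assms show ?thesis
    by (auto simp: std_simplex_def bump_def sum.distrib)
qed

text \<open>
  The letter counts of words of length \<open>N\<close> lie in the simplex of size \<open>N\<close>, so only the values
  of \<open>\<phi>\<close> there are coefficients of the sum.
\<close>

lemma word_sum_in_cone:
  assumes add: "\<And>p q. p \<in> T \<Longrightarrow> q \<in> T \<Longrightarrow> p + q \<in> T"
    and const: "\<And>c. c \<ge> 0 \<Longrightarrow> PConst c \<in> T"
    and gen: "\<And>i p. i < k \<Longrightarrow> p \<in> T \<Longrightarrow> l i * p \<in> T"
    and "\<And>v. v \<in> std_simplex k (real N) \<Longrightarrow> \<phi> v \<ge> 0"
  shows "word_sum l k N \<phi> \<in> T"
  using assms(4)
proof (induction N arbitrary: \<phi>)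
  case 0
  then show ?case by (auto simp: std_simplex_def intro!: const)
next
  case (Suc N)
  have sumT: "(\<Sum>i\<in>A. P i) \<in> T" if "finite A" "\<And>i. i \<in> A \<Longrightarrow> P i \<in> T" for A :: "nat set" and P
    using that const[of 0] by (induction A) (auto simp: PConst_zero intro: add)
  have "word_sum l k N (\<lambda>v. \<phi> (bump i v 1)) \<in> T" if "i < k" for i
  proof (rule Suc.IH)
    fix v assume "v \<in> std_simplex k (real N)"
    then show "\<phi> (bump i v 1) \<ge> 0"
      using Suc.prems[of "bump i v 1"] bump_simplex[OF _ that, of v "real N"] 
      by (simp add: add.commute)
  qed
  then show ?case by (auto intro!: sumT gen)
qed

lemma compact_box: "compact {x :: nat \<Rightarrow> real. \<forall>i. x i \<in> {- b i..b i}}"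
proof -
  have "compactin (product_topology (\<lambda>_. euclidean) UNIV) (PiE UNIV (\<lambda>i. {- b i..b i}))"
    by (subst compactin_PiE) (simp add: compactin_euclidean_iff)
  then show ?thesis
    by (simp add: euclidean_product_topology compactin_euclidean_iff PiE_UNIV_domain Pi_def)
qed

lemma compact_std_simplex: "compact (std_simplex k M)"
proof -
  have c: "continuous_on UNIV (\<lambda>v. (v :: nat \<Rightarrow> real) i)" for i
    by (rule continuous_on_product_coordinates)
  have "closed ((\<Inter>i. {v :: nat \<Rightarrow> real. 0 \<le> v i}) \<inter> (\<Inter>i\<in>{k..}. {v. v i = 0})
      \<inter> {v. (\<Sum>i<k. v i) = M})"
    by (intro closed_Int closed_INT ballI closed_Collect_le closed_Collect_eq continuous_intros c)
  also have "(\<Inter>i. {v :: nat \<Rightarrow> real. 0 \<le> v i}) \<inter> (\<Inter>i\<in>{k..}. {v. v i = 0})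
      \<inter> {v. (\<Sum>i<k. v i) = M} = std_simplex k M"
    by (auto simp: std_simplex_def)
  finally have "closed (std_simplex k M)" .
  moreover have "std_simplex k M \<subseteq> {x. \<forall>i. x i \<in> {- \<bar>M\<bar>..\<bar>M\<bar>}}"
  proof safe
    fix v i assume v: "v \<in> std_simplex k M"
    have "v i \<le> M"
    proof (cases "i < k")
      case True
      then show ?thesis
        using member_le_sum[of i "{..<k}" v] v by (auto simp: std_simplex_def)
    next
      case False
      moreover have "M \<ge> 0"
        using v by (auto simp: std_simplex_def intro!: sum_nonneg)
      ultimately show ?thesis using v by (auto simp: std_simplex_def)
    qed
    moreover have "v i \<ge> 0" using v by (simp add: std_simplex_def)
    ultimately show "v i \<in> {- \<bar>M\<bar>..\<bar>M\<bar>}" by auto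
  qed
  ultimately show ?thesis
    using compact_box[of "\<lambda>_. \<bar>M\<bar>"] by (metis compact_Int_closed inf.absorb_iff2)
qed

section \<open>A Polya theorem for elements that sum to one\<close>

text \<open>
  One function \<open>G\<close> gives the coefficients of \<open>q\<close> for all large degrees \<open>N\<close> at once, with
  \<open>1 / N\<close> as its first argument, and it is continuous up to \<open>1 / N = 0\<close>, where it becomes
  \<open>F\<close>. This form of "the coefficients converge uniformly to \<open>F\<close>" needs no error estimates.
  Continuity is required in all points \<open>x\<close>, not only in those of the simplex, because
  decrementing a coordinate leaves the simplex.
\<close>

definition bernstein_rep ::
  "(nat \<Rightarrow> rpoly) \<Rightarrow> nat \<Rightarrow> rpoly \<Rightarrow> ((nat \<Rightarrow> real) \<Rightarrow> real) \<Rightarrow> bool" where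
  "bernstein_rep l k q F \<longleftrightarrow> (\<exists>G h1. h1 > 0 \<and>
     continuous_on ({0..h1} \<times> UNIV) (\<lambda>z. G (fst z) (snd z)) \<and>
     (\<forall>N>0. 1 / real N \<le> h1 \<longrightarrow> word_sum l k N (\<lambda>v. G (1 / real N) (\<lambda>j. v j / real N)) = q) \<and>
     G 0 = F)"

text \<open>
  The same polynomial expression evaluated twice: at the ring elements \<open>l i\<close> and at the
  coordinates of a point. It is a relation and not a function because relations between the
  \<open>l i\<close> give one ring element several functions. This freedom is what later allows the
  penalty term: \<open>0\<close> is related to functions that do not vanish.
\<close>

inductive poly_fun :: "(nat \<Rightarrow> rpoly) \<Rightarrow> nat \<Rightarrow> rpoly \<Rightarrow> ((nat \<Rightarrow> real) \<Rightarrow> real) \<Rightarrow> bool"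
  for l k where
  const: "poly_fun l k (PConst c) (\<lambda>t. c)"
| gen: "i < k \<Longrightarrow> poly_fun l k (l i) (\<lambda>t. t i)"
| add: "poly_fun l k p F \<Longrightarrow> poly_fun l k q G \<Longrightarrow> poly_fun l k (p + q) (\<lambda>t. F t + G t)"
| mult: "poly_fun l k p F \<Longrightarrow> poly_fun l k q G \<Longrightarrow> poly_fun l k (p * q) (\<lambda>t. F t * G t)"

lemma bernstein_rep_const:
  assumes "(\<Sum>i<k. l i) = 1"
  shows "bernstein_rep l k (PConst c) (\<lambda>t. c)"
  unfolding bernstein_rep_def
  by (rule exI[of _ "\<lambda>h x. c"], rule exI[of _ 1]) (auto simp: word_sum_const[OF assms])

lemma bernstein_rep_scale:
  assumes "bernstein_rep l k q F"
  shows "bernstein_rep l k (PConst c * q) (\<lambda>t. c * F t)"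
proof -
  obtain G h1 where "h1 > 0" "continuous_on ({0..h1} \<times> UNIV) (\<lambda>z. G (fst z) (snd z))" "G 0 = F"
    "\<And>N. N > 0 \<Longrightarrow> 1 / real N \<le> h1 \<Longrightarrow> word_sum l k N (\<lambda>v. G (1 / real N) (\<lambda>j. v j / real N)) = q"
    using assms unfolding bernstein_rep_def by blast
  then show ?thesis
    unfolding bernstein_rep_def
    by (intro exI[of _ "\<lambda>h x. c * G h x"] exI[of _ h1])
       (auto simp: word_sum_scale intro!: continuous_intros)
qed

lemma bernstein_rep_add:
  assumes "bernstein_rep l k q F" "bernstein_rep l k q' F'"
  shows "bernstein_rep l k (q + q') (\<lambda>t. F t + F' t)"
proof -
  obtain G h1 where G: "h1 > 0" "continuous_on ({0..h1} \<times> UNIV) (\<lambda>z. G (fst z) (snd z))" "G 0 = F"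
    "\<And>N. N > 0 \<Longrightarrow> 1 / real N \<le> h1 \<Longrightarrow> word_sum l k N (\<lambda>v. G (1 / real N) (\<lambda>j. v j / real N)) = q"
    using assms(1) unfolding bernstein_rep_def by blast
  obtain G' h1' where G': "h1' > 0" "continuous_on ({0..h1'} \<times> UNIV) (\<lambda>z. G' (fst z) (snd z))" "G' 0 = F'"
    "\<And>N. N > 0 \<Longrightarrow> 1 / real N \<le> h1' \<Longrightarrow> word_sum l k N (\<lambda>v. G' (1 / real N) (\<lambda>j. v j / real N)) = q'"
    using assms(2) unfolding bernstein_rep_def by blast
  show ?thesis
    unfolding bernstein_rep_def
    by (rule exI[of _ "\<lambda>h x. G h x + G' h x"], rule exI[of _ "min h1 h1'"])
       (use G G' in \<open>auto simp: word_sum_add intro!: continuous_on_add 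
          continuous_on_subset[OF G(2)] continuous_on_subset[OF G'(2)]\<close>)
qed

lemma continuous_on_snd_coordinate:
  "continuous_on S (\<lambda>z. (snd z :: nat \<Rightarrow> real) i)"
  by (rule continuous_on_product_then_coordinatewise) (intro continuous_intros)

text \<open>
  By \<open>word_sum_coordinate\<close>, the coefficient of \<open>l i * q\<close> in degree \<open>M + 1\<close> at the counts \<open>v\<close>
  is \<open>v i / (M + 1)\<close> times the coefficient of \<open>q\<close> in degree \<open>M\<close> at \<open>v\<close> with coordinate \<open>i\<close>
  decremented. In terms of \<open>h = 1 / (M + 1)\<close> and \<open>x = h * v\<close> the old arguments are
  \<open>1 / M = h / (1 - h)\<close> and \<open>(x - h * e\<^sub>i) / (1 - h)\<close>, which are continuous at \<open>h = 0\<close>.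
\<close>

lemma bernstein_rep_gen:
  assumes "bernstein_rep l k q F" "i < k"
  shows "bernstein_rep l k (l i * q) (\<lambda>t. t i * F t)"
proof -
  obtain G h1 where G: "h1 > 0" "continuous_on ({0..h1} \<times> UNIV) (\<lambda>z. G (fst z) (snd z))" "G 0 = F"
    "\<And>N. N > 0 \<Longrightarrow> 1 / real N \<le> h1 \<Longrightarrow> word_sum l k N (\<lambda>v. G (1 / real N) (\<lambda>j. v j / real N)) = q"
    using assms(1) unfolding bernstein_rep_def by blast
  define G' where "G' h x = x i * G (h / (1 - h)) (\<lambda>j. (x j + (if j = i then - h else 0)) / (1 - h))" for h x
  define h2 where "h2 = min (1/2) (h1 / 2)"
  have h2: "h2 > 0" "h2 \<le> 1/2" using G(1) by (auto simp: h2_def)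
  \<comment> \<open>The bounds 1/2 and h1 / 2 give h / (1 - h) \<le> 2 * h \<le> h1.\<close>
  have small: "h / (1 - h) \<in> {0..h1}" if "0 \<le> h" "h \<le> h2" for h
  proof -
    have "h1 * h \<le> h1 * (1/2)" using that h2 G(1) by (intro mult_left_mono) auto
    moreover have "h \<le> h1 / 2" using that by (simp add: h2_def)
    ultimately have "h \<le> h1 * (1 - h)" by (simp add: algebra_simps)
    then show ?thesis using that h2 by (simp add: divide_simps)
  qed
  have nz: "1 - h \<noteq> 0" if "h \<le> h2" for h using that h2 by simp
  have "continuous_on ({0..h2} \<times> UNIV) (\<lambda>z. (fst z / (1 - fst z), 
      \<lambda>j. (snd z j + (if j = i then - fst z else 0)) / (1 - fst z)))"
  proof (intro continuous_on_Pair continuous_on_coordinatewise_then_product continuous_on_divide)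
    fix j
    have "continuous_on ({0..h2} \<times> UNIV) (\<lambda>z. if j = i then - fst z else (0::real))"
      by (cases "j = i") (auto intro!: continuous_intros)
    then show "continuous_on ({0..h2} \<times> UNIV) (\<lambda>z. snd z j + (if j = i then - fst z else 0))"
      by (rule continuous_on_add[OF continuous_on_snd_coordinate])
  qed (use nz in \<open>auto intro!: continuous_intros\<close>)
  then have "continuous_on ({0..h2} \<times> UNIV) (\<lambda>z. G (fst z / (1 - fst z)) 
      (\<lambda>j. (snd z j + (if j = i then - fst z else 0)) / (1 - fst z)))"
    using continuous_on_compose2[OF G(2), of "{0..h2} \<times> UNIV"] small by fastforce
  moreover have "continuous_on ({0..h2} \<times> UNIV) (\<lambda>z. (snd z :: nat \<Rightarrow> real) i)"
    by (rule continuous_on_snd_coordinate)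
  ultimately have cont: "continuous_on ({0..h2} \<times> UNIV) (\<lambda>z. G' (fst z) (snd z))"
    unfolding G'_def by (rule continuous_on_mult[rotated])
  have rep: "word_sum l k N (\<lambda>v. G' (1 / real N) (\<lambda>j. v j / real N)) = l i * q" 
    if N: "N > 0" "1 / real N \<le> h2" for N
  proof -
    have "1 / real N \<le> 1/2" using N h2 by linarith
    then obtain M where M: "N = Suc M" "M > 0" using N(1)
      by (cases N) (auto simp: divide_simps split: if_splits)
    have hh: "(1 / real N) / (1 - 1 / real N) = 1 / real M"
      using M by (simp add: field_simps)
    have "1 / real M \<le> h1" using small[of "1 / real N"] N hh by simp
    note IH = G(4)[OF M(2) this]
    have arg: "(\<lambda>j. (v j / real N + (if j = i then - (1 / real N) else 0)) / (1 - 1 / real N))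
        = (\<lambda>j. bump i v (-1) j / real M)" for v
    proof
      fix j
      have "v j / real N + (if j = i then - (1 / real N) else 0) = bump i v (-1) j / real N"
        by (simp add: bump_def diff_divide_distrib)
      moreover have "1 - 1 / real N = real M / real N"
        using M by (simp add: field_simps)
      ultimately show "(v j / real N + (if j = i then - (1 / real N) else 0)) / (1 - 1 / real N)
          = bump i v (-1) j / real M"
        using N(1) by (simp only:) simp
    qed
    have "(\<lambda>v. G' (1 / real N) (\<lambda>j. v j / real N)) = 
       (\<lambda>v. (1 / real N) * (v i * G (1 / real M) (\<lambda>j. bump i v (-1) j / real M)))"
      by (simp only: G'_def hh arg) (simp add: fun_eq_iff)
    then have "word_sum l k N (\<lambda>v. G' (1 / real N) (\<lambda>j. v j / real N)) = 
        PConst (1 / real N) * (PConst (real (Suc M)) * (l i * q))"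
      by (simp only: word_sum_scale M(1) IH
        word_sum_coordinate[OF assms(2), of l M "\<lambda>v. G (1 / real M) (\<lambda>j. v j / real M)"])
    also have "\<dots> = PConst (1 / real N * real (Suc M)) * (l i * q)"
      by (simp only: PConst_mult mult_ac)
    finally show ?thesis using M by (simp add: PConst_one)
  qed
  have "G' 0 = (\<lambda>t. t i * F t)"
    using G(3) by (simp add: G'_def fun_eq_iff cong: if_cong)
  with h2(1) cont rep show ?thesis
    unfolding bernstein_rep_def by blast
qed

text \<open>
  Multiplicativity is not available for \<open>bernstein_rep\<close> itself, but the pairs \<open>(p, F)\<close> that
  act on it by multiplication form an algebra, and it contains the generators.
\<close>

lemma bernstein_rep_mult_poly_fun:
  assumes "poly_fun l k p F" "bernstein_rep l k q G"
  shows "bernstein_rep l k (p * q) (\<lambda>t. F t * G t)"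
  using assms
proof (induction arbitrary: q G)
  case (const c) then show ?case by (rule bernstein_rep_scale)
next
  case (gen i) then show ?case by (intro bernstein_rep_gen)
next
  case (add p F p' F')
  show ?case 
    using bernstein_rep_add[OF add.IH(1)[OF add.prems] add.IH(2)[OF add.prems]] 
    by (simp add: distrib_right)
next
  case (mult p F p' F')
  show ?case using mult.IH(1)[OF mult.IH(2)[OF mult.prems]] by (simp add: mult.assoc)
qed

lemma continuous_on_poly_fun: "poly_fun l k p F \<Longrightarrow> continuous_on S F"
  by (induction rule: poly_fun.induct) 
     (auto intro!: continuous_intros continuous_on_subset[OF continuous_on_product_coordinates])

text \<open>
  Polya's theorem in a commutative ring: since \<open>F > 0\<close> on the simplex, compactness makes the
  coefficient function \<open>G\<close> positive on the simplex for all small \<open>h\<close>, so every coefficient of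
  \<open>q\<close> is nonnegative in some large degree.
\<close>

lemma polya:
  assumes unit: "(\<Sum>i<k. l i) = 1"
    and q: "poly_fun l k q F"
    and pos: "\<And>t. t \<in> std_simplex k 1 \<Longrightarrow> F t > 0"
    and add: "\<And>p q. p \<in> T \<Longrightarrow> q \<in> T \<Longrightarrow> p + q \<in> T"
    and const: "\<And>c. c \<ge> 0 \<Longrightarrow> PConst c \<in> T"
    and gen: "\<And>i p. i < k \<Longrightarrow> p \<in> T \<Longrightarrow> l i * p \<in> T"
  shows "q \<in> T"
proof -
  have "bernstein_rep l k q F"
    using bernstein_rep_mult_poly_fun[OF q bernstein_rep_const[OF unit, of 1]] 
    by (simp add: PConst_one)
  then obtain G h1 where G: "h1 > 0" "continuous_on ({0..h1} \<times> UNIV) (\<lambda>z. G (fst z) (snd z))" "G 0 = F"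
    "\<And>N. N > 0 \<Longrightarrow> 1 / real N \<le> h1 \<Longrightarrow> word_sum l k N (\<lambda>v. G (1 / real N) (\<lambda>j. v j / real N)) = q"
    unfolding bernstein_rep_def by blast
  let ?Z = "{0..h1} \<times> std_simplex k 1"
  \<comment> \<open>The projection to h of the points with G \<le> 0 is compact and avoids 0, hence stays away
      from 0.\<close>
  define B where "B = {z \<in> ?Z. G (fst z) (snd z) \<le> 0}"
  have compZ: "compact ?Z" by (intro compact_Times compact_std_simplex) auto
  have "continuous_on ?Z (\<lambda>z. G (fst z) (snd z))"
    by (rule continuous_on_subset[OF G(2)]) auto
  then have "closedin (top_of_set ?Z) (?Z \<inter> (\<lambda>z. G (fst z) (snd z)) -` {..0})"
    by (rule continuous_closedin_preimage) simp
  also have "?Z \<inter> (\<lambda>z. G (fst z) (snd z)) -` {..0} = B"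
    by (auto simp: B_def)
  finally have "compact B" using compZ by (rule closedin_compact[rotated])
  then have "compact (fst ` B)" by (intro compact_continuous_image continuous_intros)
  moreover have "0 \<notin> fst ` B" using pos G(3) by (force simp: B_def)
  ultimately obtain e where e: "e > 0" "\<And>h. h \<in> fst ` B \<Longrightarrow> e \<le> \<bar>h\<bar>"
    by (metis compact_imp_closed separate_point_closed dist_0_norm real_norm_def)
  obtain N where N: "N > 0" "1 / real N < min e h1"
    using e(1) G(1) by (metis min_less_iff_conj nat_approx_posE of_nat_Suc zero_less_Suc)
  have "word_sum l k N (\<lambda>v. G (1 / real N) (\<lambda>j. v j / real N)) \<in> T"
  proof (rule word_sum_in_cone[OF add const gen])
    fix v assume v: "v \<in> std_simplex k (real N)"
    then have "(\<lambda>j. v j / real N) \<in> std_simplex k 1"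
      using N(1) by (auto simp: std_simplex_def sum_divide_distrib[symmetric])
    moreover have "1 / real N \<in> {0..h1}" using N by auto
    moreover have "1 / real N \<notin> fst ` B" using e(2) N by force
    ultimately show "G (1 / real N) (\<lambda>j. v j / real N) \<ge> 0"
      unfolding B_def by force
  qed
  with G(4)[of N] N show ?thesis by auto
qed

section \<open>Compactness and damping multipliers\<close>

text \<open>
  The continuous function \<open>max p h\<close> is positive on \<open>C\<close>, hence at least some \<open>\<delta> > 0\<close>; where
  \<open>h < \<delta>\<close> this must be due to \<open>p\<close>.
\<close>

lemma compact_positive_gap:
  fixes p h :: "'a::topological_space \<Rightarrow> real"
  assumes "compact C" "continuous_on C p" "continuous_on C h"
    and "\<And>x. x \<in> C \<Longrightarrow> h x \<ge> 0"
    and "\<And>x. x \<in> C \<Longrightarrow> h x = 0 \<Longrightarrow> p x > 0"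
  obtains \<delta> where "\<delta> > 0" "\<And>x. x \<in> C \<Longrightarrow> h x < \<delta> \<Longrightarrow> p x \<ge> \<delta>"
proof (cases "C = {}")
  case True
  then show ?thesis using that[of 1] by auto
next
  case False
  obtain y where y: "y \<in> C" "\<And>x. x \<in> C \<Longrightarrow> max (p y) (h y) \<le> max (p x) (h x)"
    using continuous_attains_inf[OF assms(1) False continuous_on_max[OF assms(2,3)]] by blast
  have "max (p y) (h y) > 0"
    using assms(4,5)[OF y(1)] by (cases "h y = 0") auto
  moreover have "p x \<ge> max (p y) (h y)" if "x \<in> C" "h x < max (p y) (h y)" for x
    using y(2)[OF that(1)] that(2) by linarith
  ultimately show ?thesis using that by blast
qed

lemma compact_bounded_below:
  fixes p :: "'a::topological_space \<Rightarrow> real"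
  assumes "compact C" "continuous_on C p"
  obtains M where "M \<ge> 0" "\<And>x. x \<in> C \<Longrightarrow> p x \<ge> - M"
proof -
  have "bounded (p ` C)"
    using assms by (intro compact_imp_bounded compact_continuous_image)
  then obtain M where "\<And>x. x \<in> C \<Longrightarrow> \<bar>p x\<bar> \<le> M" by (auto simp: bounded_real)
  then show ?thesis using that[of "max M 0"] by (force simp: abs_le_iff)
qed

text \<open>
  Near the zeros of \<open>h\<close> the function \<open>p\<close> is positive by itself; elsewhere \<open>h\<close> is bounded away
  from zero and a large multiple of it outweighs the lower bound of \<open>p\<close>.
\<close>

lemma penalty_makes_positive:
  fixes p h :: "'a::topological_space \<Rightarrow> real"
  assumes "compact C" "continuous_on C p" "continuous_on C h"
    and "\<And>x. x \<in> C \<Longrightarrow> h x \<ge> 0"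
    and "\<And>x. x \<in> C \<Longrightarrow> h x = 0 \<Longrightarrow> p x > 0"
  obtains c where "\<And>x. x \<in> C \<Longrightarrow> p x + c * h x > 0"
proof -
  obtain \<delta> where \<delta>: "\<delta> > 0" "\<And>x. x \<in> C \<Longrightarrow> h x < \<delta> \<Longrightarrow> p x \<ge> \<delta>"
    using compact_positive_gap assms by blast
  obtain M where M: "M \<ge> 0" "\<And>x. x \<in> C \<Longrightarrow> p x \<ge> - M"
    using compact_bounded_below assms(1,2) by blast
  have "p x + (M + 1) / \<delta> * h x > 0" if "x \<in> C" for x
  proof (cases "h x < \<delta>")
    case True
    have "(M + 1) / \<delta> * h x \<ge> 0" using M(1) \<delta>(1) assms(4)[OF that] by simp
    then show ?thesis using \<delta>(2)[OF that True] \<delta>(1) by linarith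
  next
    case False
    then have "(M + 1) / \<delta> * \<delta> \<le> (M + 1) / \<delta> * h x"
      using M(1) \<delta>(1) by (intro mult_left_mono) auto
    then show ?thesis using M(2)[OF that] \<delta>(1) by simp
  qed
  then show ?thesis using that by blast
qed

text \<open>
  For \<open>t = g / U\<close> in the unit interval, Bernoulli's inequality gives
  \<open>(1 - t) ^ k * (1 + k * t) \<le> (1 - t\<^sup>2) ^ k \<le> 1\<close>. For negative \<open>g\<close> the left-hand side is
  nonpositive, as \<open>k\<close> is even.
\<close>

lemma even_power_damping_upper:
  fixes U g :: real
  assumes "U > 0" "g \<le> U" "k > 0" "even k"
  shows "((U - g) / U) ^ k * g \<le> U / real k"
proof (cases "g \<ge> 0")
  case True
  define t where "t = g / U"
  have t: "0 \<le> t" "t \<le> 1" using assms True by (auto simp: t_def)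
  have "(1 - t) ^ k * (1 + real k * t) \<le> (1 - t) ^ k * (1 + t) ^ k"
    using t Bernoulli_inequality[of t k] by (intro mult_left_mono) auto
  also have "\<dots> = (1 - t\<^sup>2) ^ k"
    by (simp add: power_mult_distrib[symmetric] power2_eq_square algebra_simps)
  also have "\<dots> \<le> 1" using t by (intro power_le_one) (auto simp: power_le_one)
  finally have "(1 - t) ^ k + (1 - t) ^ k * (real k * t) \<le> 1"
    by (simp add: distrib_left)
  moreover have "(1 - t) ^ k \<ge> 0" using t by simp
  ultimately have "(1 - t) ^ k * (real k * t) \<le> 1" by linarith
  then have "(1 - t) ^ k * t \<le> 1 / real k" using assms(3) by (simp add: field_simps)
  then have "(1 - t) ^ k * (U * t) \<le> U / real k"
    using assms(1) mult_left_mono[of _ "1 / real k" U] by (simp add: mult.left_commute)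
  moreover have "1 - t = (U - g) / U" "U * t = g" using assms(1) by (auto simp: t_def field_simps)
  ultimately show ?thesis by simp
next
  case False
  have "((U - g) / U) ^ k \<ge> 0" using assms(4) by (simp add: zero_le_even_power)
  then have "((U - g) / U) ^ k * g \<le> 0" using False by (simp add: mult_nonneg_nonpos)
  also have "0 \<le> U / real k" using assms(1) by simp
  finally show ?thesis .
qed

text \<open>
  Bernoulli's inequality again: the base exceeds one by at least \<open>\<eta> / U\<close>.
\<close>

lemma even_power_damping_negative:
  fixes U g \<eta> :: real
  assumes "U > 0" "\<eta> > 0" "g \<le> - \<eta>"
  shows "((U - g) / U) ^ k * g \<le> - (real k * \<eta>\<^sup>2 / U)"
proof -
  have "1 + real k * (- g / U) \<le> (1 + (- g / U)) ^ k"
    using assms by (intro Bernoulli_inequality) (auto simp: field_simps)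
  moreover have "1 + (- g / U) = (U - g) / U" using assms by (simp add: field_simps)
  moreover have "real k * (\<eta> / U) \<le> real k * (- g / U)"
    using assms by (intro mult_left_mono divide_right_mono) auto
  ultimately have "real k * (\<eta> / U) \<le> ((U - g) / U) ^ k" by simp
  then have "real k * (\<eta> / U) * \<eta> \<le> ((U - g) / U) ^ k * (- g)"
    using assms by (intro mult_mono) auto
  then show ?thesis by (simp add: power2_eq_square)
qed

text \<open>
  Where all constraints are violated by little, \<open>p\<close> is bounded below by some \<open>\<delta> > 0\<close>, and the
  sum of the damped terms is below \<open>\<delta>\<close>. Where some constraint is violated by at least \<open>\<eta>\<close>,
  its term is so negative that it outweighs the lower bound of \<open>p\<close> and all other terms.
\<close>

lemma damping_multipliers:
  fixes p :: "'a::topological_space \<Rightarrow> real" and g :: "'j \<Rightarrow> 'a \<Rightarrow> real"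
  assumes "compact C" "finite J" "continuous_on C p" "\<And>j. j \<in> J \<Longrightarrow> continuous_on C (g j)"
    and U: "\<And>j. j \<in> J \<Longrightarrow> U j > 0" "\<And>j x. j \<in> J \<Longrightarrow> x \<in> C \<Longrightarrow> g j x \<le> U j"
    and pos: "\<And>x. x \<in> C \<Longrightarrow> (\<forall>j\<in>J. g j x \<ge> 0) \<Longrightarrow> p x > 0"
  shows "\<exists>N. \<forall>x\<in>C. (\<Sum>j\<in>J. ((U j - g j x) / U j) ^ (2 * N) * g j x) < p x"
proof -
  define h where "h x = (\<Sum>j\<in>J. max (- g j x) 0)" for x
  have h0: "h x = 0 \<longleftrightarrow> (\<forall>j\<in>J. g j x \<ge> 0)" for x
    unfolding h_def using assms(2) by (subst sum_nonneg_eq_0_iff) (auto simp: max_def)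
  have "continuous_on C h" unfolding h_def by (intro continuous_intros assms(4))
  moreover have "h x \<ge> 0" for x unfolding h_def by (intro sum_nonneg) auto
  ultimately obtain \<delta> where \<delta>: "\<delta> > 0" "\<And>x. x \<in> C \<Longrightarrow> h x < \<delta> \<Longrightarrow> p x \<ge> \<delta>"
    using compact_positive_gap[OF assms(1,3), of h] pos h0 by metis
  obtain M where M: "M \<ge> 0" "\<And>x. x \<in> C \<Longrightarrow> p x \<ge> - M"
    using compact_bounded_below assms(1,3) by blast
  \<comment> \<open>If every violation is below \<eta>, then h < \<delta>. The summands 1 make this strict and keep
      both denominators positive when J is empty.\<close>
  define \<eta> where "\<eta> = \<delta> / (real (card J) + 1)"
  define W where "W = 1 + (\<Sum>j\<in>J. U j)"
  have \<eta>: "\<eta> > 0" using \<delta>(1) by (simp add: \<eta>_def)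
  have "(\<Sum>j\<in>J. U j) \<ge> 0" by (intro sum_nonneg less_imp_le U(1))
  then have W: "W \<ge> 1" by (simp add: W_def)
  have UW: "U j \<le> W" if "j \<in> J" for j
    using member_le_sum[of j J U] that U(1) assms(2) by (force simp: W_def)
  \<comment> \<open>The summands ensure, in this order: the damped terms sum to less than \<delta>; they sum to less
      than 1; a violation by \<eta> contributes less than - (M + 1).\<close>
  obtain N :: nat where N: "real N > W / \<delta> + W + (M + 1) * W / \<eta>\<^sup>2"
    using reals_Archimedean2 by blast
  define k where "k = 2 * N"
  have terms_nn: "W / \<delta> \<ge> 0" "(M + 1) * W / \<eta>\<^sup>2 \<ge> 0" using W M(1) \<delta>(1) by auto
  have "N > 0" using N W terms_nn by (cases N) auto
  have k: "k > 0" "even k" "real k > W / \<delta>" "real k > W" "real k > (M + 1) * W / \<eta>\<^sup>2"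
    using N W terms_nn \<open>N > 0\<close> by (auto simp: k_def)
  let ?s = "\<lambda>x j. ((U j - g j x) / U j) ^ k * g j x"
  have up: "?s x j \<le> U j / real k" if "j \<in> J" "x \<in> C" for x j
    using even_power_damping_upper U that k by blast
  have sum_up: "(\<Sum>j\<in>I. ?s x j) \<le> W / real k" if "I \<subseteq> J" "x \<in> C" for I x
  proof -
    have "(\<Sum>j\<in>I. ?s x j) \<le> (\<Sum>j\<in>I. U j / real k)"
      using that up by (intro sum_mono) auto
    also have "\<dots> = (\<Sum>j\<in>I. U j) / real k" by (simp add: sum_divide_distrib)
    also have "\<dots> \<le> (\<Sum>j\<in>J. U j) / real k"
      using that U(1) assms(2) by (intro divide_right_mono sum_mono2) (auto intro: less_imp_le)
    also have "\<dots> \<le> W / real k" by (intro divide_right_mono) (auto simp: W_def)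
    finally show ?thesis .
  qed
  have "(\<Sum>j\<in>J. ?s x j) < p x" if x: "x \<in> C" for x
  proof (cases "h x < \<delta>")
    case True
    have "W / real k < \<delta>" using k \<delta>(1) by (simp add: field_simps)
    then show ?thesis using sum_up[OF order_refl x] \<delta>(2)[OF x True] by linarith
  next
    case False
    have "\<exists>j\<in>J. - g j x \<ge> \<eta>"
    proof (rule ccontr)
      assume "\<not> ?thesis"
      then have "h x \<le> (\<Sum>j\<in>J. \<eta>)"
        unfolding h_def using \<eta> by (intro sum_mono) (auto simp: not_le less_imp_le)
      also have "\<dots> < \<delta>" using \<delta>(1) by (simp add: \<eta>_def field_simps)
      finally show False using False by simp
    qed
    then obtain j where j: "j \<in> J" "g j x \<le> - \<eta>" by force
    have "?s x j \<le> - (real k * \<eta>\<^sup>2 / U j)"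
      using even_power_damping_negative[OF U(1)[OF j(1)] \<eta> j(2)] .
    moreover have "real k * \<eta>\<^sup>2 / U j \<ge> real k * \<eta>\<^sup>2 / W"
      using UW[OF j(1)] U(1)[OF j(1)] by (intro divide_left_mono) auto
    moreover have "real k * \<eta>\<^sup>2 / W > M + 1" using k(5) \<eta> W by (simp add: field_simps)
    moreover have "W / real k < 1" using k W by simp
    moreover have "(\<Sum>i\<in>J. ?s x i) = ?s x j + (\<Sum>i\<in>J - {j}. ?s x i)"
      using j(1) assms(2) by (rule sum.remove[rotated])
    ultimately show ?thesis using sum_up[of "J - {j}" x] x M(2)[OF x] by auto
  qed
  then show ?thesis unfolding k_def by blast
qed

lemma compact_Rball: "compact (Rball n r)"
proof -
  have c: "continuous_on UNIV (\<lambda>v. (v :: nat \<Rightarrow> real) i)" for i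
    by (rule continuous_on_product_coordinates)
  have "closed ((\<Inter>i\<in>{n..}. {x :: nat \<Rightarrow> real. x i = 0}) \<inter> {x. L2_set x {..<n} \<le> r})"
    unfolding L2_set_def
    by (intro closed_Int closed_INT ballI closed_Collect_le closed_Collect_eq continuous_intros c)
  also have "(\<Inter>i\<in>{n..}. {x :: nat \<Rightarrow> real. x i = 0}) \<inter> {x. L2_set x {..<n} \<le> r} = Rball n r"
    by (auto simp: Rball_def)
  finally have "closed (Rball n r)" .
  moreover have "Rball n r \<subseteq> {x. \<forall>i. x i \<in> {- \<bar>r\<bar>..\<bar>r\<bar>}}"
  proof safe
    fix x i assume x: "x \<in> Rball n r"
    have "\<bar>x i\<bar> \<le> \<bar>r\<bar>"
    proof (cases "i < n")
      case True
      have "\<bar>x i\<bar> = L2_set x {i}" by (simp add: L2_set_def)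
      also have "\<dots> \<le> L2_set x {..<n}"
        unfolding L2_set_def using True by (intro real_sqrt_le_mono sum_mono2) auto
      finally show ?thesis using x by (auto simp: Rball_def)
    next
      case False
      then show ?thesis using x by (auto simp: Rball_def)
    qed
    then show "x i \<in> {- \<bar>r\<bar>..\<bar>r\<bar>}" by auto
  qed
  ultimately show ?thesis
    using compact_box[of "\<lambda>_. \<bar>r\<bar>"] by (metis compact_Int_closed inf.absorb_iff2)
qed

section \<open>The cone of even monomials over the ball\<close>

lemma SOMS_zero: "0 \<in> SOMS s"
  unfolding SOMS_def by (auto intro!: exI[of _ "{}"])

lemma SOMS_single:
  assumes "Poly_Mapping.keys a \<subseteq> {..<s}" "c \<ge> 0"
  shows "Poly_Mapping.single (a + a) c \<in> SOMS s"
  unfolding SOMS_def using assms by (auto intro!: exI[of _ "{a}"] exI[of _ "\<lambda>_. c"])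

lemma SOMS_add:
  assumes "p \<in> SOMS s" "q \<in> SOMS s"
  shows "p + q \<in> SOMS s"
proof -
  obtain A c where A: "finite A" "\<forall>a\<in>A. Poly_Mapping.keys a \<subseteq> {..<s}" "\<forall>a\<in>A. c a \<ge> (0::real)"
    and p: "p = (\<Sum>a\<in>A. Poly_Mapping.single (a + a) (c a))"
    using assms(1) unfolding SOMS_def by blast
  obtain B d where B: "finite B" "\<forall>a\<in>B. Poly_Mapping.keys a \<subseteq> {..<s}" "\<forall>a\<in>B. d a \<ge> (0::real)"
    and q: "q = (\<Sum>a\<in>B. Poly_Mapping.single (a + a) (d a))"
    using assms(2) unfolding SOMS_def by blast
  let ?c = "\<lambda>a. if a \<in> A then c a else 0" and ?d = "\<lambda>a. if a \<in> B then d a else 0"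
  have "p = (\<Sum>a\<in>A \<union> B. Poly_Mapping.single (a + a) (?c a))"
    unfolding p by (rule sum.mono_neutral_cong_left) (use A B in auto)
  moreover have "q = (\<Sum>a\<in>A \<union> B. Poly_Mapping.single (a + a) (?d a))"
    unfolding q by (rule sum.mono_neutral_cong_left) (use A B in auto)
  ultimately have "p + q = (\<Sum>a\<in>A \<union> B. Poly_Mapping.single (a + a) (?c a + ?d a))"
    by (simp add: single_add sum.distrib)
  then show ?thesis
    unfolding SOMS_def mem_Collect_eq using A B
    by (intro exI[of _ "A \<union> B"] exI[of _ "\<lambda>a. ?c a + ?d a"]) auto
qed

lemma SOMS_sum: "(\<And>i. i \<in> A \<Longrightarrow> P i \<in> SOMS s) \<Longrightarrow> sum P A \<in> SOMS s"
  by (induction A rule: infinite_finite_induct) (auto intro: SOMS_zero SOMS_add)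

lemma SOMS_single_mult:
  assumes "Poly_Mapping.keys b \<subseteq> {..<s}" "d \<ge> 0" "q \<in> SOMS s"
  shows "Poly_Mapping.single (b + b) d * q \<in> SOMS s"
proof -
  obtain A c where A: "finite A" "\<forall>a\<in>A. Poly_Mapping.keys a \<subseteq> {..<s}" "\<forall>a\<in>A. c a \<ge> (0::real)"
    and q: "q = (\<Sum>a\<in>A. Poly_Mapping.single (a + a) (c a))"
    using assms(3) unfolding SOMS_def by blast
  have "Poly_Mapping.single ((b + a) + (b + a)) (d * c a) \<in> SOMS s" if "a \<in> A" for a
  proof (rule SOMS_single)
    show "Poly_Mapping.keys (b + a) \<subseteq> {..<s}"
      using that A(2) assms(1) keys_add[of b a] by blast
  qed (use that A(3) assms(2) in auto)
  then have "(\<Sum>a\<in>A. Poly_Mapping.single ((b + a) + (b + a)) (d * c a)) \<in> SOMS s"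
    by (rule SOMS_sum)
  also have "(\<Sum>a\<in>A. Poly_Mapping.single ((b + a) + (b + a)) (d * c a)) =
      Poly_Mapping.single (b + b) d * q"
    by (simp add: q sum_distrib_left mult_single add_ac)
  finally show ?thesis .
qed

definition ball_cone :: "nat \<Rightarrow> real \<Rightarrow> rpoly set" where
  "ball_cone n r = {psubst (ball_subst n r) \<alpha> + psubst (ball_subst n r) \<beta> * ball_poly n r
     | \<alpha> \<beta>. \<alpha> \<in> SOMS (2 * n + 1) \<and> \<beta> \<in> SOMS (2 * n + 1)}"

lemma ball_coneI:
  assumes "\<alpha> \<in> SOMS (2 * n + 1)" "\<beta> \<in> SOMS (2 * n + 1)"
    and "p = psubst (ball_subst n r) \<alpha> + psubst (ball_subst n r) \<beta> * ball_poly n r"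
  shows "p \<in> ball_cone n r"
  using assms unfolding ball_cone_def by blast

lemma ball_cone_add:
  assumes "p \<in> ball_cone n r" "q \<in> ball_cone n r"
  shows "p + q \<in> ball_cone n r"
proof -
  obtain \<alpha> \<beta> where p: "\<alpha> \<in> SOMS (2 * n + 1)" "\<beta> \<in> SOMS (2 * n + 1)"
    "p = psubst (ball_subst n r) \<alpha> + psubst (ball_subst n r) \<beta> * ball_poly n r"
    using assms(1) unfolding ball_cone_def by blast
  obtain \<alpha>' \<beta>' where q: "\<alpha>' \<in> SOMS (2 * n + 1)" "\<beta>' \<in> SOMS (2 * n + 1)"
    "q = psubst (ball_subst n r) \<alpha>' + psubst (ball_subst n r) \<beta>' * ball_poly n r"
    using assms(2) unfolding ball_cone_def by blast
  show ?thesis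
    by (rule ball_coneI[OF SOMS_add[OF p(1) q(1)] SOMS_add[OF p(2) q(2)]])
       (simp add: p(3) q(3) psubst_simps algebra_simps)
qed

lemma ball_cone_const:
  assumes "c \<ge> 0"
  shows "PConst c \<in> ball_cone n r"
proof (rule ball_coneI[OF _ SOMS_zero])
  show "Poly_Mapping.single (0 + 0) c \<in> SOMS (2 * n + 1)"
    by (rule SOMS_single) (use assms in auto)
qed (simp add: psubst_simps)

lemma ball_cone_square_mult:
  assumes "i < 2 * n + 1" "d \<ge> 0" "p \<in> ball_cone n r"
  shows "PConst d * ball_subst n r i ^ 2 * p \<in> ball_cone n r"
proof -
  obtain \<alpha> \<beta> where p: "\<alpha> \<in> SOMS (2 * n + 1)" "\<beta> \<in> SOMS (2 * n + 1)"
    "p = psubst (ball_subst n r) \<alpha> + psubst (ball_subst n r) \<beta> * ball_poly n r"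
    using assms(3) unfolding ball_cone_def by blast
  let ?e = "Poly_Mapping.single i (1::nat)"
  have e: "Poly_Mapping.keys ?e \<subseteq> {..<2 * n + 1}" using assms(1) by simp
  show ?thesis
    by (rule ball_coneI[OF SOMS_single_mult[OF e assms(2) p(1)] SOMS_single_mult[OF e assms(2) p(2)]])
       (simp add: p(3) psubst_simps monom_eval_add power2_eq_square algebra_simps)
qed

text \<open>
  Multiplying by \<open>u = r\<^sup>2 - \<parallel>x\<parallel>\<^sup>2\<close> exchanges the two parts: the second one collects the factor
  \<open>u\<^sup>2\<close>, an even monomial, and the first one becomes the coefficient of \<open>u\<close>.
\<close>

lemma ball_cone_ball_poly_mult:
  assumes "d \<ge> 0" "p \<in> ball_cone n r"
  shows "PConst d * ball_poly n r * p \<in> ball_cone n r"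
proof -
  obtain \<alpha> \<beta> where p: "\<alpha> \<in> SOMS (2 * n + 1)" "\<beta> \<in> SOMS (2 * n + 1)"
    "p = psubst (ball_subst n r) \<alpha> + psubst (ball_subst n r) \<beta> * ball_poly n r"
    using assms(2) unfolding ball_cone_def by blast
  let ?e = "Poly_Mapping.single (2 * n) (1::nat)"
  have e: "Poly_Mapping.keys ?e \<subseteq> {..<2 * n + 1}" by simp
  have z: "Poly_Mapping.keys (0 :: nat \<Rightarrow>\<^sub>0 nat) \<subseteq> {..<2 * n + 1}" by simp
  show ?thesis
    by (rule ball_coneI[OF SOMS_single_mult[OF e assms(1) p(2)] SOMS_single_mult[OF z assms(1) p(1)]])
       (simp add: p(3) psubst_simps monom_eval_add ball_subst_def algebra_simps)
qed

section \<open>Barycentric coordinates of the ball\<close>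

definition bary_scale :: "nat \<Rightarrow> real \<Rightarrow> real" where
  "bary_scale n r = 2 * (real n + 1) * r\<^sup>2"

text \<open>
  The generators \<open>y\<^sub>i\<^sup>2\<close>, \<open>z\<^sub>i\<^sup>2\<close> and \<open>2 * u\<close>, divided by their constant sum.
\<close>

definition simplex_coord :: "nat \<Rightarrow> real \<Rightarrow> nat \<Rightarrow> rpoly" where
  "simplex_coord n r i =
     (if i < 2 * n then PConst (1 / bary_scale n r) * ball_subst n r i ^ 2
      else PConst (2 / bary_scale n r) * ball_poly n r)"

text \<open>
  The point of \<open>\<real>\<^sup>n\<close> with \<open>y\<^sub>i\<^sup>2 - z\<^sub>i\<^sup>2 = 4 * r * x\<^sub>i\<close>, where \<open>y\<^sub>i\<^sup>2\<close> and \<open>z\<^sub>i\<^sup>2\<close> are read off from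
  the barycentric coordinates; the factor is \<open>bary_scale n r / (4 * r)\<close>.
\<close>

definition coord_of_simplex :: "nat \<Rightarrow> real \<Rightarrow> (nat \<Rightarrow> real) \<Rightarrow> nat \<Rightarrow> real" where
  "coord_of_simplex n r t i =
     (if i < n then (real n + 1) * r / 2 * (t i - t (n + i)) else 0)"

lemma simplex_coord_mult_ball_cone:
  assumes "i < 2 * n + 1" "p \<in> ball_cone n r"
  shows "simplex_coord n r i * p \<in> ball_cone n r"
  using ball_cone_square_mult[OF assms(1) _ assms(2)] ball_cone_ball_poly_mult[OF _ assms(2)]
  by (simp add: simplex_coord_def bary_scale_def)

lemma sum_lessThan_add: "(\<Sum>i<a + b. f i) = (\<Sum>i<a. f i) + (\<Sum>i<b. f (a + i))"
  for f :: "nat \<Rightarrow> 'a::comm_monoid_add"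
  by (induction b) (simp_all add: add_ac)

lemma sum_lessThan_double_Suc:
  "(\<Sum>i<2 * n + 1. f i) = (\<Sum>i<n. f i + f (n + i)) + f (2 * n)"
  for f :: "nat \<Rightarrow> 'a::comm_monoid_add"
  using sum_lessThan_add[of f n n] by (simp add: mult_2 sum.distrib)

lemma PConst_of_nat: "PConst (real k) = of_nat k"
  by (induction k) (simp_all add: PConst_zero PConst_add PConst_one)

lemma PConst_numeral: "PConst (numeral w) = numeral w"
  by (simp add: PConst_def)

lemma PConst_scaled:
  assumes "C \<noteq> 0"
  shows "PConst C * (PConst (c / C) * p) = PConst c * p"
proof -
  have "PConst C * (PConst (c / C) * p) = PConst (C * (c / C)) * p"
    by (simp only: PConst_mult mult.assoc)
  then show ?thesis using assms by simp
qed

lemma PConst_cancel: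
  assumes "C \<noteq> 0" "PConst C * p = PConst C * q"
  shows "p = q"
proof -
  have "PConst (1 / C) * (PConst C * p) = PConst (1 / C) * (PConst C * q)"
    using assms(2) by simp
  then have "PConst (1 / C * C) * p = PConst (1 / C * C) * q"
    by (simp only: PConst_mult mult.assoc)
  then show ?thesis using assms(1) by (simp add: PConst_one)
qed

lemma scaled_simplex_coord:
  assumes "r > 0"
  shows "i < n \<Longrightarrow> PConst (bary_scale n r) * simplex_coord n r i = (PVar i + PConst r)\<^sup>2"
    and "i < n \<Longrightarrow> PConst (bary_scale n r) * simplex_coord n r (n + i) = (PConst r - PVar i)\<^sup>2"
    and "PConst (bary_scale n r) * simplex_coord n r (2 * n) = 2 * ball_poly n r"
proof -
  have C: "bary_scale n r \<noteq> 0" using assms(1) by (simp add: bary_scale_def)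
  show "i < n \<Longrightarrow> PConst (bary_scale n r) * simplex_coord n r i = (PVar i + PConst r)\<^sup>2"
    "i < n \<Longrightarrow> PConst (bary_scale n r) * simplex_coord n r (n + i) = (PConst r - PVar i)\<^sup>2"
    "PConst (bary_scale n r) * simplex_coord n r (2 * n) = 2 * ball_poly n r"
    unfolding simplex_coord_def 
    by (simp_all add: PConst_scaled[OF C] PConst_one PConst_numeral ball_subst_def)
qed

lemma sum_simplex_coord:
  assumes "r > 0"
  shows "(\<Sum>i<2 * n + 1. simplex_coord n r i) = 1"
proof (rule PConst_cancel)
  let ?C = "bary_scale n r"
  show "?C \<noteq> 0" using assms by (simp add: bary_scale_def)
  have "PConst ?C * (\<Sum>i<2 * n + 1. simplex_coord n r i)
      = (\<Sum>i<n. (PVar i + PConst r)\<^sup>2 + (PConst r - PVar i)\<^sup>2) + 2 * ball_poly n r"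
    unfolding sum_lessThan_double_Suc distrib_left sum_distrib_left
    by (intro arg_cong2[where f = "(+)"] sum.cong refl) (simp_all add: scaled_simplex_coord[OF assms])
  also have "\<dots> = (\<Sum>i<n. 2 * PVar i ^ 2 + 2 * PConst r ^ 2) + 2 * ball_poly n r"
    by (rule arg_cong2[where f = "(+)", OF sum.cong refl])
       (simp_all add: power2_eq_square algebra_simps)
  also have "\<dots> = 2 * (of_nat n + 1) * PConst r ^ 2"
    by (simp add: sum.distrib sum_distrib_left[symmetric] ball_poly_def PConst_power algebra_simps)
  also have "\<dots> = PConst ?C * 1"
    unfolding bary_scale_def
    by (simp only: PConst_mult PConst_add PConst_one PConst_of_nat PConst_numeral PConst_power mult_1_right)
  finally show "PConst ?C * (\<Sum>i<2 * n + 1. simplex_coord n r i) = PConst ?C * 1" .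
qed

lemma poly_fun_diff:
  assumes "poly_fun l k p F" "poly_fun l k q G"
  shows "poly_fun l k (p - q) (\<lambda>t. F t - G t)"
proof -
  have "PConst (- 1) = - 1" by (simp add: PConst_def single_uminus)
  then show ?thesis
    using poly_fun.add[OF assms(1) poly_fun.mult[OF poly_fun.const[of l k "- 1"] assms(2)]] by simp
qed

lemma poly_fun_sum:
  assumes "\<And>i. i \<in> A \<Longrightarrow> poly_fun l k (P i) (F i)"
  shows "poly_fun l k (\<Sum>i\<in>A. P i) (\<lambda>t. \<Sum>i\<in>A. F i t)"
  using assms
  by (induction A rule: infinite_finite_induct)
     (auto intro: poly_fun.add poly_fun.const[of l k 0, unfolded PConst_zero])

lemma poly_fun_prod:
  assumes "\<And>i. i \<in> A \<Longrightarrow> poly_fun l k (P i) (F i)"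
  shows "poly_fun l k (\<Prod>i\<in>A. P i) (\<lambda>t. \<Prod>i\<in>A. F i t)"
  using assms
  by (induction A rule: infinite_finite_induct)
     (auto intro: poly_fun.mult poly_fun.const[of l k 1, unfolded PConst_one])

lemma poly_fun_power:
  assumes "poly_fun l k p F"
  shows "poly_fun l k (p ^ m) (\<lambda>t. F t ^ m)"
  using poly_fun_prod[of "{..<m}" l k "\<lambda>_. p" "\<lambda>_. F"] assms by simp

lemma poly_fun_peval:
  assumes "f \<in> polys n" "\<And>i. i < n \<Longrightarrow> poly_fun l k (PVar i) (\<lambda>t. X t i)"
  shows "poly_fun l k f (\<lambda>t. peval (X t) f)"
proof -
  have "poly_fun l k (\<Sum>a\<in>Poly_Mapping.keys f. PConst (Poly_Mapping.lookup f a) *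
        (\<Prod>i\<in>Poly_Mapping.keys a. PVar i ^ Poly_Mapping.lookup a i)) (\<lambda>t. peval (X t) f)"
    unfolding peval_def using assms
    by (intro poly_fun_sum poly_fun.mult poly_fun.const poly_fun_prod poly_fun_power)
       (auto simp: polys_def)
  then show ?thesis
    by (simp only: single_eq_PConst_prod[symmetric] sum_single_keys)
qed

lemma poly_fun_PVar:
  assumes "r > 0" "i < n"
  shows "poly_fun (simplex_coord n r) (2 * n + 1) (PVar i) (\<lambda>t. coord_of_simplex n r t i)"
proof -
  let ?l = "simplex_coord n r" and ?C = "bary_scale n r" and ?c = "(real n + 1) * r / 2"
  have "PConst (4 * r) * (PConst ?c * (?l i - ?l (n + i))) = PConst ?C * ?l i - PConst ?C * ?l (n + i)"
  proof -
    have "?C = 4 * r * ?c" by (simp add: bary_scale_def power2_eq_square)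
    then show ?thesis by (simp only: PConst_mult mult.assoc right_diff_distrib)
  qed
  also have "\<dots> = PConst (4 * r) * PVar i"
    unfolding scaled_simplex_coord(1,2)[OF assms]
    by (simp add: PConst_mult PConst_numeral power2_eq_square algebra_simps)
  finally have "PConst ?c * (?l i - ?l (n + i)) = PVar i"
    by (rule PConst_cancel[rotated]) (use assms(1) in simp)
  moreover have "poly_fun ?l (2 * n + 1) (PConst ?c * (?l i - ?l (n + i)))
      (\<lambda>t. ?c * (t i - t (n + i)))"
    using assms(2) by (intro poly_fun.mult poly_fun.const poly_fun_diff poly_fun.gen) auto
  ultimately show ?thesis using assms(2) by (simp add: coord_of_simplex_def)
qed

text \<open>
  If \<open>y\<^sub>i\<^sup>2\<close> has its correct value \<open>(x\<^sub>i + r)\<^sup>2\<close>, the definition of \<open>x\<^sub>i\<close> forces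
  \<open>z\<^sub>i\<^sup>2 = (r - x\<^sub>i)\<^sup>2\<close>. As all coordinates sum to one, the last one is then a positive multiple
  of \<open>r\<^sup>2 - \<parallel>x\<parallel>\<^sup>2\<close>, and it is nonnegative on the simplex.
\<close>

lemma coord_of_simplex_in_Rball:
  assumes r: "r > 0" and t: "t \<in> std_simplex (2 * n + 1) 1"
    and eq: "\<And>i. i < n \<Longrightarrow> bary_scale n r * t i = (coord_of_simplex n r t i + r)\<^sup>2"
  shows "coord_of_simplex n r t \<in> Rball n r"
proof -
  let ?x = "coord_of_simplex n r t" and ?C = "bary_scale n r"
  have eq': "?C * t (n + i) = (r - ?x i)\<^sup>2" if "i < n" for i
  proof -
    have "4 * r * ?x i = ?C * t i - ?C * t (n + i)"
      unfolding right_diff_distrib[symmetric]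
      using that by (simp add: coord_of_simplex_def bary_scale_def power2_eq_square)
    then show ?thesis using eq[OF that] by (simp add: power2_eq_square algebra_simps)
  qed
  have "?C = ?C * (\<Sum>i<2 * n + 1. t i)" using t by (simp add: std_simplex_def)
  also have "\<dots> = (\<Sum>i<n. (?x i + r)\<^sup>2 + (r - ?x i)\<^sup>2) + ?C * t (2 * n)"
    unfolding sum_lessThan_double_Suc distrib_left sum_distrib_left
    by (intro arg_cong2[where f = "(+)"] sum.cong refl) (simp_all add: eq eq')
  also have "\<dots> = (\<Sum>i<n. 2 * (?x i)\<^sup>2 + 2 * r\<^sup>2) + ?C * t (2 * n)"
    by (simp add: power2_eq_square algebra_simps)
  also have "\<dots> = 2 * (\<Sum>i<n. (?x i)\<^sup>2) + 2 * real n * r\<^sup>2 + ?C * t (2 * n)"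
    by (simp add: sum.distrib sum_distrib_left)
  finally have "?C = 2 * (\<Sum>i<n. (?x i)\<^sup>2) + 2 * real n * r\<^sup>2 + ?C * t (2 * n)" .
  moreover have "?C = 2 * real n * r\<^sup>2 + 2 * r\<^sup>2" by (simp add: bary_scale_def algebra_simps)
  ultimately have "2 * (\<Sum>i<n. (?x i)\<^sup>2) = 2 * r\<^sup>2 - ?C * t (2 * n)" by linarith
  moreover have "?C * t (2 * n) \<ge> 0" using t by (simp add: std_simplex_def bary_scale_def)
  ultimately have "(\<Sum>i<n. (?x i)\<^sup>2) \<le> r\<^sup>2" by linarith
  then have "L2_set ?x {..<n} \<le> r" unfolding L2_set_def using r by (simp add: real_le_lsqrt)
  then show ?thesis by (simp add: Rball_def coord_of_simplex_def)
qed

text \<open>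
  The function \<open>F\<close> on the simplex that belongs to \<open>f\<close> need not be positive outside the image
  of the ball. The penalty \<open>H\<close> vanishes only at points of this image, and it represents the zero polynomial.
\<close>

lemma positive_on_ball_imp_ball_cone:
  assumes r: "r > 0" and f: "f \<in> polys n" and pos: "\<And>x. x \<in> Rball n r \<Longrightarrow> peval x f > 0"
  shows "f \<in> ball_cone n r"
proof -
  let ?l = "simplex_coord n r" and ?k = "2 * n + 1" and ?C = "bary_scale n r"
  define F where "F t = peval (coord_of_simplex n r t) f" for t
  define H where "H t = (\<Sum>i<n. (?C * t i - (coord_of_simplex n r t i + r)\<^sup>2)\<^sup>2)" for t
  have X: "poly_fun ?l ?k (PVar i) (\<lambda>t. coord_of_simplex n r t i)" if "i < n" for i
    using poly_fun_PVar[OF r that] .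
  have F: "poly_fun ?l ?k f F"
    unfolding F_def using poly_fun_peval[OF f X] .
  have "poly_fun ?l ?k (\<Sum>i<n. (PConst ?C * ?l i - (PVar i + PConst r)\<^sup>2)\<^sup>2) H"
    unfolding H_def
    by (intro poly_fun_sum poly_fun_power poly_fun_diff poly_fun.mult poly_fun.add poly_fun.const
        poly_fun.gen X) auto
  also have "(\<Sum>i<n. (PConst ?C * ?l i - (PVar i + PConst r)\<^sup>2)\<^sup>2) = 0"
    by (simp add: scaled_simplex_coord[OF r])
  finally have H: "poly_fun ?l ?k 0 H" .
  have "F t > 0" if t: "t \<in> std_simplex ?k 1" "H t = 0" for t
  proof -
    have "\<forall>i\<in>{..<n}. (?C * t i - (coord_of_simplex n r t i + r)\<^sup>2)\<^sup>2 = 0"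
      using t(2) unfolding H_def by (subst (asm) sum_nonneg_eq_0_iff) auto
    then have "coord_of_simplex n r t \<in> Rball n r"
      by (intro coord_of_simplex_in_Rball[OF r t(1)]) auto
    then show ?thesis unfolding F_def by (rule pos)
  qed
  moreover have "H t \<ge> 0" for t unfolding H_def by (intro sum_nonneg) auto
  ultimately obtain c where c: "\<And>t. t \<in> std_simplex ?k 1 \<Longrightarrow> F t + c * H t > 0"
    using penalty_makes_positive[OF compact_std_simplex continuous_on_poly_fun[OF F] 
      continuous_on_poly_fun[OF H]] by blast
  have "poly_fun ?l ?k f (\<lambda>t. F t + c * H t)"
    using poly_fun.add[OF F poly_fun.mult[OF poly_fun.const[of ?l ?k c] H]] by simp
  from polya[OF sum_simplex_coord[OF r] this c ball_cone_add ball_cone_const simplex_coord_mult_ball_cone]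
  show ?thesis by blast
qed

theorem theorem4:
  fixes K :: "nat \<Rightarrow> rpoly set"
    and n m :: nat
    and g :: "nat \<Rightarrow> rpoly"
    and r :: real
    and U :: "nat \<Rightarrow> real"
    and p :: rpoly
  assumes "poly_class K"
    and "\<And>s. SOMS s \<subseteq> K s"
    and "\<And>j. j \<in> {1..m} \<Longrightarrow> g j \<in> polys n"
    and "r > 0"
    and "\<And>j. j \<in> {1..m} \<Longrightarrow> U j > 0"
    and "\<And>j x. j \<in> {1..m} \<Longrightarrow> x \<in> Rball n r \<Longrightarrow> peval x (g j) \<le> U j"
    and "p \<in> polys n"
    and "\<And>x. x \<in> Rball n r \<Longrightarrow> (\<forall>j\<in>{1..m}. peval x (g j) \<ge> 0) \<Longrightarrow> peval x p > 0"
  shows "\<exists>\<alpha>\<^sub>0\<in>K (2 * n + 1). \<exists>\<alpha>\<^sub>1\<in>K (2 * n + 1). \<exists>\<rho> :: nat \<Rightarrow> rpoly.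
    (\<forall>j\<in>{1..m}. \<rho> j \<in> K 1) \<and>
    p = psubst (ball_subst n r) \<alpha>\<^sub>0
        + psubst (ball_subst n r) \<alpha>\<^sub>1 * ball_poly n r
        + (\<Sum>j=1..m. psubst (\<lambda>_. PConst (U j) - g j) (\<rho> j) * g j)"
proof -
  have "\<exists>N. \<forall>x\<in>Rball n r.
      (\<Sum>j=1..m. ((U j - peval x (g j)) / U j) ^ (2 * N) * peval x (g j)) < peval x p"
    by (rule damping_multipliers[of "Rball n r" "{1..m}" "\<lambda>x. peval x p" "\<lambda>j x. peval x (g j)" U,
          OF compact_Rball finite_atLeastAtMost continuous_on_peval continuous_on_peval assms(5,6,8)])
  then obtain N where N: "\<And>x. x \<in> Rball n r \<Longrightarrow>
      (\<Sum>j=1..m. ((U j - peval x (g j)) / U j) ^ (2 * N) * peval x (g j)) < peval x p"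
    by blast
  define \<rho> :: "nat \<Rightarrow> rpoly" where
    "\<rho> j = Poly_Mapping.single (Poly_Mapping.single 0 N + Poly_Mapping.single 0 N) ((1 / U j) ^ (2 * N))" for j
  define S where "S = (\<Sum>j=1..m. psubst (\<lambda>_. PConst (U j) - g j) (\<rho> j) * g j)"
  have \<rho>: "\<rho> j \<in> SOMS 1" if "j \<in> {1..m}" for j
    unfolding \<rho>_def using assms(5)[OF that] by (intro SOMS_single) auto
  have S: "S = (\<Sum>j=1..m. PConst ((1 / U j) ^ (2 * N)) * (PConst (U j) - g j) ^ (2 * N) * g j)"
    by (simp add: S_def \<rho>_def psubst_simps monom_eval_add mult_2 power_add)
  have "p - S \<in> ball_cone n r"
  proof (rule positive_on_ball_imp_ball_cone[OF assms(4)])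
    show "p - S \<in> polys n"
      unfolding S using assms(3,7)
      by (intro polys_diff polys_sum polys_mult polys_power polys_PConst) auto
    fix x assume "x \<in> Rball n r"
    then show "peval x (p - S) > 0"
      using N by (simp add: S peval_simps power_divide)
  qed
  then obtain \<alpha> \<beta> where "\<alpha> \<in> SOMS (2 * n + 1)" "\<beta> \<in> SOMS (2 * n + 1)"
    "p - S = psubst (ball_subst n r) \<alpha> + psubst (ball_subst n r) \<beta> * ball_poly n r"
    unfolding ball_cone_def by blast
  moreover from this(3) have "p = psubst (ball_subst n r) \<alpha> + psubst (ball_subst n r) \<beta> * ball_poly n r + S"
    by (simp add: algebra_simps)
  ultimately show ?thesis
    using assms(2) \<rho> unfolding S_def by blast
qed

end
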